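(* Let $A$ be any (adaptive) algorithm which makes $q=o(\sqrt{R}\cdot\varepsilon^{-2})$ calls to \textsc{Samp}, followed by $q$ calls to \textsc{Pcond}. Then \[\left|\Pr_{\mathcal{D}\leftarrow\mathcal{P}}\big[A^{\mathcal{D}}\text{ outputs ACCEPT}\big]-\Pr\big[A^{\mathcal{D}^*}\text{ outputs ACCEPT}\big]\right|<\tfrac13,\] where $A^{\mathcal{D}}$ denotes $A$ run with \textsc{Samp} and \textsc{Pcond} access to $\mathcal{D}$.
   Context: Let $K=\Theta(\varepsilon^{-2}\log N)$ and $R=\Theta\!\left(\frac{\log N}{\log(\varepsilon^{-1}\log N)}\right)$ be integers with $N=K+K^2+\cdots+K^{2R}$. For $1\le r\le 2R$ let $B_r$ be the interval of integers from $1+\sum_{i=1}^{r-1}K^i$ to $\sum_{i=1}^rK^i$, so $|B_r|=K^r$ and the $B_r$ partition $[N]$. Define $\mathcal{D}^*$ by $D^*(i)=\frac{1}{2R\cdot K^r}$ for $i\in B_r$. The random distribution $\mathcal{D}\leftarrow\mathcal{P}$ is obtained by drawing a uniformly random $s\in\{0,1\}^R$ and, for each $1\le r\le R$: if $s_r=0$, setting $D(i)=\frac{1-\varepsilon}{2R K^{2r-1}}$ for $i\in B_{2r-1}$ and $D(i)=\frac{1+\varepsilon}{2RK^{2r}}$ for $i\in B_{2r}$; if $s_r=1$, setting $D(i)=\frac{1+\varepsilon}{2R K^{2r-1}}$ for $i\in B_{2r-1}$ and $D(i)=\frac{1-\varepsilon}{2RK^{2r}}$ for $i\in B_{2r}$.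 \textsc{Samp} returns an independent sample from the distribution; \textsc{Pcond}$(x,y)$ returns $x$ with probability $\frac{D(x)}{D(x)+D(y)}$ and $y$ otherwise.
   Formalization: The parameter ε is positive and bounded above by a constant less than 1 (any fixed ε in (0,1) or ε → 0); if 1−ε tends to 0 faster than 1/K, a single Pcond query between B_1 and B_2 gives a gap tending to 1/2, so the claim fails. *)

theory Defs
  imports "HOL-Probability.Probability" "HOL-Library.Landau_Symbols"
begin

section \<open>The hard instance\<close>

definition block :: "nat \<Rightarrow> nat \<Rightarrow> nat set" where
  "block K j = {1 + (\<Sum>i=1..j-1. K ^ i) .. (\<Sum>i=1..j. K ^ i)}"

text \<open>The blocks with index in \<open>{1..2*R}\<close> are disjoint, so the sum below has at most one nonzero
  term: its value is \<open>w j / (2 * R * K ^ j)\<close> at a point of block \<open>j\<close>, and zero outside the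
  domain \<open>{1..N}\<close>.\<close>

definition block_density :: "nat \<Rightarrow> nat \<Rightarrow> (nat \<Rightarrow> real) \<Rightarrow> nat \<Rightarrow> real" where
  "block_density K R w i =
     (\<Sum>j=1..2*R. if i \<in> block K j then w j / (2 * real R * real K ^ j) else 0)"

definition block_pmf :: "nat \<Rightarrow> nat \<Rightarrow> (nat \<Rightarrow> real) \<Rightarrow> nat pmf" where
  "block_pmf K R w = embed_pmf (block_density K R w)"

definition D_star :: "nat \<Rightarrow> nat \<Rightarrow> nat pmf" where
  "D_star K R = block_pmf K R (\<lambda>_. 1)"

text \<open>Blocks \<open>2*r-1\<close> and \<open>2*r\<close> are both governed by the bit \<open>s r\<close>, where \<open>r = (j+1) div 2\<close>.\<close>

definition tilt :: "real \<Rightarrow> (nat \<Rightarrow> bool) \<Rightarrow> nat \<Rightarrow> real" where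
  "tilt \<epsilon> s j =
     (let b = s ((j + 1) div 2) in
      if odd j then (if b then 1 + \<epsilon> else 1 - \<epsilon>) else (if b then 1 - \<epsilon> else 1 + \<epsilon>))"

definition D_tilted :: "nat \<Rightarrow> nat \<Rightarrow> real \<Rightarrow> (nat \<Rightarrow> bool) \<Rightarrow> nat pmf" where
  "D_tilted K R \<epsilon> s = block_pmf K R (tilt \<epsilon> s)"

definition random_D :: "nat \<Rightarrow> nat \<Rightarrow> real \<Rightarrow> nat pmf pmf" where
  "random_D K R \<epsilon> = map_pmf (D_tilted K R \<epsilon>) (pmf_of_set ({1..R} \<rightarrow>\<^sub>E (UNIV :: bool set)))"


section \<open>Well-definedness of the distributions\<close>

lemma card_block: "j \<ge> 1 \<Longrightarrow> card (block K j) = K ^ j"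
  by (cases j) (auto simp: block_def)

lemma finite_block [simp]: "finite (block K j)"
  by (simp add: block_def)

lemma block_disjoint:
  assumes "i < j"
  shows "block K i \<inter> block K j = {}"
proof -
  have "(\<Sum>l=1..i. K ^ l) \<le> (\<Sum>l=1..j-1. K ^ l)"
    using assms by (intro sum_mono2) auto
  thus ?thesis by (auto simp: block_def)
qed

lemma Union_blocks: "(\<Union>j\<in>{1..m}. block K j) = {1..\<Sum>i=1..m. K ^ i}"
proof (induction m)
  case (Suc m)
  have "(\<Union>j\<in>{1..Suc m}. block K j) = (\<Union>j\<in>{1..m}. block K j) \<union> block K (Suc m)"
    by (auto simp: atLeastAtMostSuc_conv)
  also have "\<dots> = {1..\<Sum>i=1..Suc m. K ^ i}"
    unfolding Suc.IH by (auto simp: block_def)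
  finally show ?case .
qed auto

lemma block_density_eq:
  assumes "j \<in> {1..2*R}" "i \<in> block K j"
  shows "block_density K R w i = w j / (2 * real R * real K ^ j)"
proof -
  have "i \<notin> block K l" if "l \<noteq> j" for l
    using block_disjoint[of l j K] block_disjoint[of j l K] assms(2) that
    by (cases l j rule: linorder_cases) auto
  hence "block_density K R w i =
      (\<Sum>l=1..2*R. if l = j then w j / (2 * real R * real K ^ j) else 0)"
    unfolding block_density_def using assms(2) by (intro sum.cong) auto
  thus ?thesis using assms(1) by simp
qed

lemma pmf_block_pmf:
  assumes "K \<ge> 1" "R \<ge> 1" "\<And>j. j \<in> {1..2*R} \<Longrightarrow> w j \<ge> 0" "(\<Sum>j=1..2*R. w j) = 2 * real R"
  shows "pmf (block_pmf K R w) i = block_density K R w i"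
  unfolding block_pmf_def
proof (rule pmf_embed_pmf)
  show nonneg: "0 \<le> block_density K R w x" for x
    unfolding block_density_def using assms(3) by (intro sum_nonneg) auto
  let ?A = "\<Union>j\<in>{1..2*R}. block K j"
  have "(\<integral>\<^sup>+x. ennreal (block_density K R w x) \<partial>count_space UNIV) =
      (\<Sum>x\<in>?A. ennreal (block_density K R w x))"
  proof (rule nn_integral_count_space')
    show "ennreal (block_density K R w x) = 0" if "x \<in> UNIV" "x \<notin> ?A" for x
      using that(2) by (auto simp: block_density_def intro!: sum.neutral)
  qed auto
  also have "\<dots> = ennreal (\<Sum>x\<in>?A. block_density K R w x)"
    using nonneg by (simp add: sum_ennreal)
  also have "(\<Sum>x\<in>?A. block_density K R w x) =
      (\<Sum>j=1..2*R. \<Sum>x\<in>?A. if x \<in> block K j then w j / (2 * real R * real K ^ j) else 0)"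
    unfolding block_density_def by (rule sum.swap)
  also have "\<dots> = (\<Sum>j=1..2*R. w j / (2 * real R))"
  proof (rule sum.cong)
    fix j assume j: "j \<in> {1..2*R}"
    have "(\<Sum>x\<in>?A. if x \<in> block K j then w j / (2 * real R * real K ^ j) else 0) =
        (\<Sum>x\<in>?A \<inter> block K j. w j / (2 * real R * real K ^ j))"
      by (rule sum.inter_restrict[symmetric]) auto
    also have "?A \<inter> block K j = block K j" using j by auto
    also have "(\<Sum>x\<in>block K j. w j / (2 * real R * real K ^ j)) = w j / (2 * real R)"
      using assms(1) j by (simp add: card_block)
    finally show "(\<Sum>x\<in>?A. if x \<in> block K j then w j / (2 * real R * real K ^ j) else 0) =
        w j / (2 * real R)" .
  qed auto
  also have "\<dots> = 1"
    using assms(2,4) by (simp flip: sum_divide_distrib)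
  finally show "(\<integral>\<^sup>+x. ennreal (block_density K R w x) \<partial>count_space UNIV) = 1" by simp
qed

lemma pmf_D_star:
  assumes "K \<ge> 1" "R \<ge> 1"
  shows "pmf (D_star K R) i = block_density K R (\<lambda>_. 1) i"
  unfolding D_star_def using assms by (intro pmf_block_pmf) auto

lemma sum_tilt: "(\<Sum>j=1..2*R. tilt \<epsilon> s j) = 2 * real R"
proof (induction R)
  case (Suc R)
  have "(\<Sum>j=1..2*Suc R. tilt \<epsilon> s j) =
      (\<Sum>j=1..2*R. tilt \<epsilon> s j) + tilt \<epsilon> s (2*R+1) + tilt \<epsilon> s (2*R+2)"
    by simp
  moreover have "tilt \<epsilon> s (2*R+1) + tilt \<epsilon> s (2*R+2) = 2"
    by (auto simp: tilt_def Let_def)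
  ultimately show ?case using Suc.IH by simp
qed auto

lemma pmf_D_tilted:
  assumes "K \<ge> 1" "R \<ge> 1" "0 \<le> \<epsilon>" "\<epsilon> \<le> 1"
  shows "pmf (D_tilted K R \<epsilon> s) i = block_density K R (tilt \<epsilon> s) i"
  unfolding D_tilted_def using assms sum_tilt
  by (intro pmf_block_pmf) (auto simp: tilt_def Let_def)


section \<open>Oracle algorithms\<close>

text \<open>An adaptive randomised algorithm: it may toss internal coins (\<open>Flip\<close>), call one of the two
  oracles and continue depending on the answer, or stop and output \<open>True\<close> (ACCEPT) or \<open>False\<close>.\<close>

datatype alg =
    Output bool
  | Flip "alg pmf"
  | Samp "nat \<Rightarrow> alg"
  | Pcond nat nat "nat \<Rightarrow> alg"

definition pcond :: "nat pmf \<Rightarrow> nat \<Rightarrow> nat \<Rightarrow> nat pmf" where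
  "pcond D x y =
     map_pmf (\<lambda>b. if b then x else y) (bernoulli_pmf (pmf D x / (pmf D x + pmf D y)))"

primrec run :: "nat pmf \<Rightarrow> alg \<Rightarrow> bool pmf" where
  "run D (Output b) = return_pmf b"
| "run D (Flip p) = bind_pmf (map_pmf (run D) p) (\<lambda>r. r)"
| "run D (Samp k) = bind_pmf D (\<lambda>x. run D (k x))"
| "run D (Pcond x y k) = bind_pmf (pcond D x y) (\<lambda>z. run D (k z))"

text \<open>\<open>samp_then_pcond N m n A\<close>: on every computation path, \<open>A\<close> makes at most \<open>m\<close> calls to
  \<open>Samp\<close> and then at most \<open>n\<close> calls to \<open>Pcond\<close>, all of them on points of the domain \<open>{1..N}\<close>;
  after the first call to \<open>Pcond\<close> no further call to \<open>Samp\<close> is allowed.\<close>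

inductive samp_then_pcond :: "nat \<Rightarrow> nat \<Rightarrow> nat \<Rightarrow> alg \<Rightarrow> bool" for N where
  "samp_then_pcond N m n (Output b)"
| "(\<forall>A\<in>set_pmf p. samp_then_pcond N m n A) \<Longrightarrow> samp_then_pcond N m n (Flip p)"
| "(\<forall>x\<in>{1..N}. samp_then_pcond N m n (k x)) \<Longrightarrow> samp_then_pcond N (Suc m) n (Samp k)"
| "x \<in> {1..N} \<Longrightarrow> y \<in> {1..N} \<Longrightarrow> (\<forall>z\<in>{x, y}. samp_then_pcond N 0 n (k z)) \<Longrightarrow>
     samp_then_pcond N m (Suc n) (Pcond x y k)"

definition accept_prob :: "nat pmf \<Rightarrow> alg \<Rightarrow> real" where
  "accept_prob D A = pmf (run D A) True"

definition accept_prob_random :: "nat pmf pmf \<Rightarrow> alg \<Rightarrow> real" where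
  "accept_prob_random P A = pmf (bind_pmf P (\<lambda>D. run D A)) True"

end

theory Submission
  imports Defs
begin

text \<open>In two different blocks the point of the higher block has at most a fraction \<open>O(1/K)\<close> of the
  joint weight, and inside one block \<open>Pcond\<close> is a fair coin; so replacing every answer of \<open>Pcond\<close>
  by one drawn for \<open>D_star\<close> changes acceptance probabilities by \<open>O(q/K)\<close>, which is
  \<open>o(sqrt R / ln N) = o(1)\<close>.
  What is left uses only \<open>Samp\<close>, and the chi-square divergence of \<open>q\<close> samples from the random
  distribution against \<open>q\<close> samples from \<open>D_star\<close> is
  \<open>E (1 + \<epsilon>\<^sup>2 T / R)\<^sup>q - 1 \<le> cosh (q \<epsilon>\<^sup>2 / R)\<^sup>R - 1 \<le> exp (q\<^sup>2 \<epsilon>\<^sup>4 / (2 R)) - 1 = o(1)\<close>,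
  where \<open>T\<close> is the sum of \<open>R\<close> random signs recording the agreements of two independent copies
  of the hidden string.\<close>

section \<open>Acceptance probabilities as expectations\<close>

lemma accept_prob_nonneg: "0 \<le> accept_prob D A"
  and accept_prob_le_1: "accept_prob D A \<le> 1"
  by (auto simp: accept_prob_def pmf_le_1)

lemma accept_prob_Output: "accept_prob D (Output b) = of_bool b"
  by (simp add: accept_prob_def)

lemma accept_prob_Flip:
  "accept_prob D (Flip p) = measure_pmf.expectation p (accept_prob D)"
  by (simp add: accept_prob_def[abs_def] pmf_bind bind_map_pmf)

lemma accept_prob_Samp:
  "accept_prob D (Samp k) = measure_pmf.expectation D (\<lambda>x. accept_prob D (k x))"
  by (simp add: accept_prob_def pmf_bind)

lemma accept_prob_Pcond:
  "accept_prob D (Pcond x y k) = measure_pmf.expectation (pcond D x y) (\<lambda>z. accept_prob D (k z))"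
  by (simp add: accept_prob_def pmf_bind)

lemma set_pmf_pcond: "set_pmf (pcond D x y) \<subseteq> {x, y}"
  by (auto simp: pcond_def)

text \<open>This form also covers \<open>x = y\<close> and two points of weight zero, where division
  by zero gives bias 0 and the answer is always \<open>y\<close>.\<close>

lemma expectation_pcond:
  fixes h :: "nat \<Rightarrow> real"
  shows "measure_pmf.expectation (pcond D x y) h =
    h x * (pmf D x / (pmf D x + pmf D y)) + h y * (1 - pmf D x / (pmf D x + pmf D y))"
proof -
  have "pmf D x / (pmf D x + pmf D y) \<le> 1"
    using pmf_nonneg[of D x] pmf_nonneg[of D y] unfolding divide_le_eq_1 by linarith
  then show ?thesis
    by (simp add: pcond_def)
qed

lemma integrable_accept_prob: "integrable (measure_pmf p) (\<lambda>a. accept_prob (f a) (g a))"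
  by (rule measure_pmf.integrable_const_bound[where B = 1])
    (auto simp: accept_prob_nonneg accept_prob_le_1)

lemma abs_expectation_le:
  fixes f :: "'a \<Rightarrow> real"
  assumes "\<And>a. a \<in> set_pmf p \<Longrightarrow> \<bar>f a\<bar> \<le> B"
  shows "\<bar>measure_pmf.expectation p f\<bar> \<le> B"
proof -
  have "integrable (measure_pmf p) f"
    by (rule measure_pmf.integrable_const_bound[where B = B]) (use assms in \<open>auto simp: AE_measure_pmf_iff\<close>)
  then have "measure_pmf.expectation p (\<lambda>a. \<bar>f a\<bar>) \<le> B"
    by (intro measure_pmf.integral_le_const) (use assms in \<open>auto simp: AE_measure_pmf_iff\<close>)
  then show ?thesis
    using integral_abs_bound[of "measure_pmf p" f] by linarith
qed

section \<open>Eliminating \<open>Pcond\<close> by simulation\<close>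

text \<open>Answering the calls to \<open>Pcond\<close> with internal coins distributed according to \<open>P\<close> turns an
  algorithm into one that only calls \<open>Samp\<close>.\<close>

primrec simulate_pcond :: "nat pmf \<Rightarrow> alg \<Rightarrow> alg" where
  "simulate_pcond P (Output b) = Output b"
| "simulate_pcond P (Flip p) = Flip (map_pmf (simulate_pcond P) p)"
| "simulate_pcond P (Samp k) = Samp (\<lambda>x. simulate_pcond P (k x))"
| "simulate_pcond P (Pcond x y k) = Flip (map_pmf (\<lambda>z. simulate_pcond P (k z)) (pcond P x y))"

text \<open>Below a \<open>Pcond\<close> node the \<open>Samp\<close> budget drops to 0; once that
  node is simulated by a \<open>Flip\<close>, the branches must again carry the budget of the
  node.\<close>

lemma samp_then_pcond_mono:
  "samp_then_pcond N m n A \<Longrightarrow> m \<le> m' \<Longrightarrow> samp_then_pcond N m' n A"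
proof (induction arbitrary: m' rule: samp_then_pcond.induct)
  case (3 m n k)
  then show ?case
    by (cases m') (auto intro!: samp_then_pcond.intros)
qed (auto intro!: samp_then_pcond.intros)

lemma samp_then_pcond_simulate_pcond:
  "samp_then_pcond N m n A \<Longrightarrow> samp_then_pcond N m 0 (simulate_pcond P A)"
proof (induction rule: samp_then_pcond.induct)
  case (4 x y n k m)
  have "samp_then_pcond N m 0 (simulate_pcond P (k z))" if "z \<in> set_pmf (pcond P x y)" for z
    using 4 that set_pmf_pcond[of P x y] samp_then_pcond_mono[of N 0 0] by blast
  then show ?case
    by (auto intro!: samp_then_pcond.intros)
qed (auto intro!: samp_then_pcond.intros)

text \<open>Coins with the law of the true oracle answers leave the output distribution
  unchanged.\<close>

lemma accept_prob_simulate_pcond_same: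
  "accept_prob D (simulate_pcond D A) = accept_prob D A"
proof (induction A)
  case (Flip p)
  then show ?case
    by (auto simp: accept_prob_Flip intro!: integral_cong_AE simp: AE_measure_pmf_iff)
next
  case (Samp k)
  then show ?case by (simp add: accept_prob_Samp)
next
  case (Pcond x y k)
  then show ?case by (simp add: accept_prob_Flip accept_prob_Pcond)
qed (simp add: accept_prob_Output)

text \<open>A hybrid argument: each simulated call shifts the law of one answer by at most \<delta>,
  while \<open>Flip\<close> and \<open>Samp\<close> only average the errors of their branches. The
  support condition keeps all samples in the domain, where the induction hypothesis applies.\<close>

lemma accept_prob_simulate_pcond_diff:
  assumes "samp_then_pcond N m n A"
    and supp: "set_pmf D \<subseteq> {1..N}"
    and \<delta>: "\<And>x y. x \<in> {1..N} \<Longrightarrow> y \<in> {1..N} \<Longrightarrow>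
      \<bar>pmf D x / (pmf D x + pmf D y) - pmf P x / (pmf P x + pmf P y)\<bar> \<le> \<delta>"
    and "0 \<le> \<delta>"
  shows "\<bar>accept_prob D A - accept_prob D (simulate_pcond P A)\<bar> \<le> real n * \<delta>"
  using assms(1)
proof (induction rule: samp_then_pcond.induct)
  case (1 m n b)
  then show ?case using \<open>0 \<le> \<delta>\<close> by (simp add: accept_prob_Output)
next
  case (2 p m n)
  have "accept_prob D (Flip p) - accept_prob D (simulate_pcond P (Flip p)) =
      measure_pmf.expectation p (\<lambda>a. accept_prob D a - accept_prob D (simulate_pcond P a))"
    by (simp add: accept_prob_Flip Bochner_Integration.integral_diff integrable_accept_prob)
  then show ?case
    using abs_expectation_le[of p] 2 by simp
next
  case (3 m n k)
  have "accept_prob D (Samp k) - accept_prob D (simulate_pcond P (Samp k)) =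
      measure_pmf.expectation D (\<lambda>x. accept_prob D (k x) - accept_prob D (simulate_pcond P (k x)))"
    by (simp add: accept_prob_Samp Bochner_Integration.integral_diff integrable_accept_prob)
  moreover have "\<bar>accept_prob D (k x) - accept_prob D (simulate_pcond P (k x))\<bar> \<le> real n * \<delta>"
    if "x \<in> set_pmf D" for x
    using 3 that supp by blast
  ultimately show ?case
    using abs_expectation_le[of D] by simp
next
  case (4 x y n k m)
  let ?p = "pmf D x / (pmf D x + pmf D y)" and ?r = "pmf P x / (pmf P x + pmf P y)"
  let ?f = "\<lambda>z. accept_prob D (k z)" and ?g = "\<lambda>z. accept_prob D (simulate_pcond P (k z))"
  \<comment> \<open>The intermediate hybrid draws only this answer from \<open>pcond P x y\<close>
    and leaves later calls unsimulated.\<close>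
  have "\<bar>measure_pmf.expectation (pcond P x y) (\<lambda>z. ?f z - ?g z)\<bar> \<le> real n * \<delta>"
    using 4 set_pmf_pcond[of P x y] by (intro abs_expectation_le) blast
  moreover have "accept_prob D (simulate_pcond P (Pcond x y k)) =
      measure_pmf.expectation (pcond P x y) ?g"
    by (simp add: accept_prob_Flip)
  moreover have "measure_pmf.expectation (pcond P x y) (\<lambda>z. ?f z - ?g z) =
      measure_pmf.expectation (pcond P x y) ?f - measure_pmf.expectation (pcond P x y) ?g"
    by (simp add: Bochner_Integration.integral_diff integrable_accept_prob)
  moreover have "\<bar>accept_prob D (Pcond x y k) - measure_pmf.expectation (pcond P x y) ?f\<bar> \<le> \<delta>"
  proof -
    \<comment> \<open>The change of bias is multiplied by a difference of two acceptance
      probabilities, which has absolute value at most 1.\<close>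
    have "accept_prob D (Pcond x y k) - measure_pmf.expectation (pcond P x y) ?f =
        (?f x - ?f y) * (?p - ?r)"
      unfolding accept_prob_Pcond expectation_pcond
      by (simp only: right_diff_distrib left_diff_distrib)
    also have "\<bar>\<dots>\<bar> \<le> 1 * \<delta>"
      unfolding abs_mult
      using \<delta>[of x y] 4 accept_prob_nonneg[of D "k x"] accept_prob_nonneg[of D "k y"]
        accept_prob_le_1[of D "k x"] accept_prob_le_1[of D "k y"]
      by (intro mult_mono) auto
    finally show ?thesis by simp
  qed
  ultimately show ?case by (simp add: algebra_simps)
qed

section \<open>A second-moment bound for algorithms that only sample\<close>

text \<open>The inner product in L2(P) of the likelihood ratios of \<open>D\<close> and
  \<open>D'\<close> with respect to \<open>P\<close>, when \<open>P\<close> has finite support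
  containing theirs. It is multiplicative over independent samples.\<close>

definition correlation :: "nat pmf \<Rightarrow> nat pmf \<Rightarrow> nat pmf \<Rightarrow> real" where
  "correlation P D D' = (\<Sum>x\<in>set_pmf P. pmf D x * pmf D' x / pmf P x)"

text \<open>The form is \<open>\<Sum>x. (\<Sum>i. c i * pmf (D i)\<^sup>m x)\<^sup>2 / pmf P\<^sup>m x\<close> over
  \<open>m\<close>-tuples \<open>x\<close> of samples, where the exponent denotes the \<open>m\<close>-fold product distribution.
  With \<open>c = - 1\<close> at \<open>P\<close> and uniform weights on the other distributions, it is the chi-square
  divergence of the mixture of their products from the product of \<open>P\<close>. Arbitrary coefficients
  are needed for the induction over the algorithm: after a sample \<open>x\<close> each \<open>c i\<close> is multiplied
  by a likelihood ratio.\<close>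

definition correlation_form :: "nat pmf \<Rightarrow> ('i \<Rightarrow> nat pmf) \<Rightarrow> 'i set \<Rightarrow> nat \<Rightarrow> ('i \<Rightarrow> real) \<Rightarrow> real" where
  "correlation_form P D I m c = (\<Sum>i\<in>I. \<Sum>j\<in>I. c i * c j * correlation P (D i) (D j) ^ m)"

lemma correlation_form_0: "correlation_form P D I 0 c = (\<Sum>i\<in>I. c i)\<^sup>2"
  by (simp add: correlation_form_def power2_eq_square sum_product)

text \<open>Splits off one sample: one factor of each correlation power is expanded as a sum over
  \<open>x\<close> and moved outside both index sums.\<close>

lemma correlation_form_Suc:
  "correlation_form P D I (Suc m) c =
    (\<Sum>x\<in>set_pmf P. pmf P x * correlation_form P D I m (\<lambda>i. c i * pmf (D i) x / pmf P x))"
proof -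
  let ?G = "\<lambda>i j. correlation P (D i) (D j)"
  have "(\<Sum>x\<in>set_pmf P. pmf P x * correlation_form P D I m (\<lambda>i. c i * pmf (D i) x / pmf P x)) =
      (\<Sum>x\<in>set_pmf P. \<Sum>i\<in>I. \<Sum>j\<in>I. c i * c j * ?G i j ^ m * (pmf (D i) x * pmf (D j) x / pmf P x))"
    unfolding correlation_form_def sum_distrib_left
    by (intro sum.cong refl) (auto simp: field_simps set_pmf_iff)
  also have "\<dots> = (\<Sum>i\<in>I. \<Sum>x\<in>set_pmf P. \<Sum>j\<in>I. c i * c j * ?G i j ^ m * (pmf (D i) x * pmf (D j) x / pmf P x))"
    by (rule sum.swap)
  also have "\<dots> = (\<Sum>i\<in>I. \<Sum>j\<in>I. \<Sum>x\<in>set_pmf P. c i * c j * ?G i j ^ m * (pmf (D i) x * pmf (D j) x / pmf P x))"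
    by (intro sum.cong refl sum.swap)
  also have "\<dots> = correlation_form P D I (Suc m) c"
    unfolding correlation_form_def power_Suc2 sum_distrib_left[symmetric]
    by (simp add: correlation_def mult.assoc)
  finally show ?thesis by simp
qed

lemma expectation_square_le:
  fixes f :: "'a \<Rightarrow> real"
  assumes "finite (set_pmf P)"
  shows "(\<Sum>x\<in>set_pmf P. pmf P x * f x)\<^sup>2 \<le> (\<Sum>x\<in>set_pmf P. pmf P x * (f x)\<^sup>2)"
  using convex_on_sum[OF assms set_pmf_not_empty convex_power2, of "pmf P" f] assms
  by (simp add: sum_pmf_eq_1)

text \<open>The inductive step for one sample. The combination on the left is a
  \<open>P\<close>-average of reweighted combinations, so Jensen's inequality for the square applies
  before the bound for each \<open>x\<close>.\<close>

lemma square_le_correlation_form_Suc: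
  assumes fin: "finite (set_pmf P)"
    and supp: "\<And>i. i \<in> I \<Longrightarrow> set_pmf (D i) \<subseteq> set_pmf P"
    and v: "\<And>x. x \<in> set_pmf P \<Longrightarrow>
      (\<Sum>i\<in>I. c i * pmf (D i) x / pmf P x * u i x)\<^sup>2
        \<le> correlation_form P D I m (\<lambda>i. c i * pmf (D i) x / pmf P x)"
  shows "(\<Sum>i\<in>I. c i * measure_pmf.expectation (D i) (u i))\<^sup>2 \<le> correlation_form P D I (Suc m) c"
proof -
  have "c i * measure_pmf.expectation (D i) (u i) =
      (\<Sum>x\<in>set_pmf P. pmf P x * (c i * pmf (D i) x / pmf P x * u i x))" if "i \<in> I" for i
  proof -
    have "measure_pmf.expectation (D i) (u i) = (\<Sum>x\<in>set_pmf P. u i x * pmf (D i) x)"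
      using fin supp[OF that] by (intro integral_measure_pmf_real) auto
    then show ?thesis
      by (auto simp: sum_distrib_left set_pmf_iff intro!: sum.cong)
  qed
  then have "(\<Sum>i\<in>I. c i * measure_pmf.expectation (D i) (u i)) =
      (\<Sum>x\<in>set_pmf P. pmf P x * (\<Sum>i\<in>I. c i * pmf (D i) x / pmf P x * u i x))"
    by (simp add: sum_distrib_left sum.swap[of _ I])
  then have "(\<Sum>i\<in>I. c i * measure_pmf.expectation (D i) (u i))\<^sup>2 \<le>
      (\<Sum>x\<in>set_pmf P. pmf P x * (\<Sum>i\<in>I. c i * pmf (D i) x / pmf P x * u i x)\<^sup>2)"
    using expectation_square_le[OF fin] by simp
  also have "\<dots> \<le> correlation_form P D I (Suc m) c"
    unfolding correlation_form_Suc by (intro sum_mono mult_left_mono v) auto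
  finally show ?thesis .
qed

text \<open>Needed for algorithms that stop with part of their sample budget unspent. It also shows
  that the form is nonnegative.\<close>

lemma square_sum_le_correlation_form:
  assumes fin: "finite (set_pmf P)" and supp: "\<And>i. i \<in> I \<Longrightarrow> set_pmf (D i) \<subseteq> set_pmf P"
  shows "(\<Sum>i\<in>I. c i)\<^sup>2 \<le> correlation_form P D I m c"
proof (induction m arbitrary: c)
  case 0
  then show ?case by (simp add: correlation_form_0)
next
  case (Suc m)
  then show ?case
    using square_le_correlation_form_Suc[OF fin supp, where c = c and m = m and u = "\<lambda>_ _. 1"] by simp
qed

text \<open>Induction over the algorithm, with \<open>c\<close> arbitrary so that a sample can
  reweight it. The condition \<open>n = 0\<close> is a premise, so that the induction rule sees a
  variable and the \<open>Pcond\<close> case is contradictory.\<close>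

lemma square_accept_prob_le_correlation_form:
  assumes "samp_then_pcond N m n A" and "n = 0"
    and "set_pmf P = {1..N}" and supp: "\<And>i. i \<in> I \<Longrightarrow> set_pmf (D i) \<subseteq> {1..N}"
  shows "(\<Sum>i\<in>I. c i * accept_prob (D i) A)\<^sup>2 \<le> correlation_form P D I m c"
  using assms(1,2)
proof (induction arbitrary: c rule: samp_then_pcond.induct)
  case (1 m n b)
  then show ?case
    using square_sum_le_correlation_form[of P I D c m] assms(3,4)
      order_trans[OF zero_le_power2 square_sum_le_correlation_form[of P I D c m]]
    by (cases b) (auto simp: accept_prob_Output)
next
  case (2 p m n)
  have "(\<Sum>i\<in>I. c i * accept_prob (D i) (Flip p)) =
      measure_pmf.expectation p (\<lambda>a. \<Sum>i\<in>I. c i * accept_prob (D i) a)"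
    by (simp add: accept_prob_Flip Bochner_Integration.integral_sum integrable_accept_prob)
  \<comment> \<open>The bound is the same for all branches of the coin, so it passes to their
    average.\<close>
  also have "\<bar>\<dots>\<bar> \<le> sqrt (correlation_form P D I m c)"
    using 2 by (intro abs_expectation_le real_le_rsqrt) auto
  finally show ?case
    by (rule sqrt_ge_absD)
next
  case (3 m n k)
  have IH: "(\<Sum>i\<in>I. c i * accept_prob (D i) (k x))\<^sup>2 \<le> correlation_form P D I m c"
    if "x \<in> set_pmf P" for x c
    using 3 that assms(3) by blast
  show ?case
    unfolding accept_prob_Samp
  proof (rule square_le_correlation_form_Suc)
    show "(\<Sum>i\<in>I. c i * pmf (D i) x / pmf P x * accept_prob (D i) (k x))\<^sup>2
        \<le> correlation_form P D I m (\<lambda>i. c i * pmf (D i) x / pmf P x)" if "x \<in> set_pmf P" for x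
      using IH[OF that] .
  qed (use assms(3,4) in auto)
qed auto

section \<open>Supports and \<open>Pcond\<close> biases of the hard instance\<close>

lemma tilt_bounds:
  assumes "0 \<le> \<epsilon>" "\<epsilon> \<le> 1"
  shows "1 - \<epsilon> \<le> tilt \<epsilon> s j" "tilt \<epsilon> s j \<le> 2"
  using assms by (auto simp: tilt_def Let_def)

lemma block_density_outside:
  "i \<notin> {1..\<Sum>j=1..2*R. K ^ j} \<Longrightarrow> block_density K R w i = 0"
  unfolding Union_blocks[symmetric] block_density_def by (intro sum.neutral) auto

lemma block_density_pos:
  assumes "K \<ge> 1" "R \<ge> 1" "\<And>j. j \<in> {1..2*R} \<Longrightarrow> 0 < w j" "i \<in> {1..\<Sum>j=1..2*R. K ^ j}"
  shows "0 < block_density K R w i"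
proof -
  obtain j where j: "j \<in> {1..2*R}" "i \<in> block K j"
    using assms(4) unfolding Union_blocks[symmetric] by blast
  show ?thesis
    unfolding block_density_eq[OF j] using assms(1,2) assms(3)[OF j(1)] by simp
qed

lemma set_pmf_D_star:
  assumes "K \<ge> 1" "R \<ge> 1"
  shows "set_pmf (D_star K R) = {1..\<Sum>j=1..2*R. K ^ j}"
proof -
  have "block_density K R (\<lambda>_. 1) i \<noteq> 0 \<longleftrightarrow> i \<in> {1..\<Sum>j=1..2*R. K ^ j}" for i
    using block_density_pos[OF assms, of "\<lambda>_. 1" i] block_density_outside[of i K R "\<lambda>_. 1"]
    by (cases "i \<in> {1..\<Sum>j=1..2*R. K ^ j}") auto
  then show ?thesis
    unfolding set_eq_iff set_pmf_iff pmf_D_star[OF assms] by blast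
qed

lemma set_pmf_D_tilted:
  assumes "K \<ge> 1" "R \<ge> 1" "0 \<le> \<epsilon>" "\<epsilon> \<le> 1"
  shows "set_pmf (D_tilted K R \<epsilon> s) \<subseteq> {1..\<Sum>j=1..2*R. K ^ j}"
  unfolding subset_iff set_pmf_iff pmf_D_tilted[OF assms] using block_density_outside by blast

text \<open>The weights differ by a factor of at most 2/\<eta>, whereas the higher block has at
  least \<open>K\<close> times as many points to share its weight.\<close>

lemma higher_block_share_le:
  assumes KR: "K \<ge> 1" "R \<ge> 1"
    and w: "\<And>j. j \<in> {1..2*R} \<Longrightarrow> \<eta> \<le> w j \<and> w j \<le> 2" and \<eta>: "0 < \<eta>"
    and ij: "i \<in> {1..2*R}" "j \<in> {1..2*R}" "i < j" and xy: "x \<in> block K i" "y \<in> block K j"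
  shows "block_density K R w y / (block_density K R w x + block_density K R w y) \<le> 2 / (\<eta> * real K)"
proof -
  let ?X = "block_density K R w x" and ?Y = "block_density K R w y"
  have X: "?X = w i / (2 * real R * real K ^ i)" and Y: "?Y = w j / (2 * real R * real K ^ j)"
    using ij xy by (simp_all add: block_density_eq)
  have pos: "0 < w i" "0 < w j" "0 < ?X" "0 < ?Y"
    using w[OF ij(1)] w[OF ij(2)] \<eta> KR unfolding X Y by auto
  have "?Y / (?X + ?Y) \<le> ?Y / ?X"
    using pos by (intro divide_left_mono) auto
  also have "\<dots> = w j / w i * (real K ^ i / real K ^ j)"
    using KR pos unfolding X Y by (simp add: field_simps)
  also have "\<dots> \<le> 2 / \<eta> * (1 / real K)"
  proof (rule mult_mono)
    show "w j / w i \<le> 2 / \<eta>"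
      using w[OF ij(1)] w[OF ij(2)] \<eta> pos by (intro frac_le) auto
    have "real K * real K ^ i = real K ^ Suc i" by simp
    also have "\<dots> \<le> real K ^ j"
      using KR ij by (intro power_increasing) auto
    finally show "real K ^ i / real K ^ j \<le> 1 / real K"
      using KR by (simp add: field_simps)
  qed (use \<eta> in auto)
  finally show ?thesis by simp
qed

text \<open>The weights of both distributions lie between \<open>1 - \<epsilon>\<close> and 2. In
  different blocks, both shares of the higher point therefore lie in the same short interval
  starting at 0; in one block both biases are 1/2.\<close>

lemma pcond_prob_D_tilted_diff:
  fixes s :: "nat \<Rightarrow> bool"
  assumes KR: "K \<ge> 1" "R \<ge> 1" and \<epsilon>: "0 \<le> \<epsilon>" "\<epsilon> < 1"
    and "x \<in> {1..\<Sum>j=1..2*R. K ^ j}" "y \<in> {1..\<Sum>j=1..2*R. K ^ j}"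
  defines "D \<equiv> D_tilted K R \<epsilon> s" and "P \<equiv> D_star K R"
  shows "\<bar>pmf D x / (pmf D x + pmf D y) - pmf P x / (pmf P x + pmf P y)\<bar> \<le> 2 / ((1 - \<epsilon>) * real K)"
proof -
  let ?N = "\<Sum>j=1..2*R. K ^ j" and ?\<delta> = "2 / ((1 - \<epsilon>) * real K)"
  define f where "f w x y = block_density K R w x / (block_density K R w x + block_density K R w y)"
    for w x y
  have w: "1 - \<epsilon> \<le> w j \<and> w j \<le> 2" if "w \<in> {tilt \<epsilon> s, \<lambda>_. 1}" for w j
    using that tilt_bounds[of \<epsilon> s j] \<epsilon> by auto
  have pos: "0 < block_density K R w z" if "w \<in> {tilt \<epsilon> s, \<lambda>_. 1}" "z \<in> {1..?N}" for w z
  proof (rule block_density_pos[OF KR _ that(2)])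
    show "0 < w j" for j using w[OF that(1), of j] \<epsilon> by linarith
  qed
  have f01: "0 \<le> f w x y" "f w x y \<le> 1" and f_swap: "f w x y = 1 - f w y x"
    if "w \<in> {tilt \<epsilon> s, \<lambda>_. 1}" "x \<in> {1..?N}" "y \<in> {1..?N}" for w x y
    using pos[OF that(1,2)] pos[OF that(1,3)] by (auto simp: f_def field_simps)
  have small: "f w y x \<le> ?\<delta>"
    if "w \<in> {tilt \<epsilon> s, \<lambda>_. 1}" "i \<in> {1..2*R}" "j \<in> {1..2*R}" "i < j" "x \<in> block K i" "y \<in> block K j"
    for w i j x y
    using higher_block_share_le[OF KR, of "1 - \<epsilon>" w i j x y] w[OF that(1)] that \<epsilon>
    by (simp add: f_def add.commute)
  obtain i j where ij: "i \<in> {1..2*R}" "x \<in> block K i" "j \<in> {1..2*R}" "y \<in> block K j"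
    using assms(5,6) unfolding Union_blocks[symmetric] by blast
  have "\<bar>f (tilt \<epsilon> s) x y - f (\<lambda>_. 1) x y\<bar> \<le> ?\<delta>"
  proof (cases i j rule: linorder_cases)
    case less
    have "f w y x \<in> {0..?\<delta>}" if "w \<in> {tilt \<epsilon> s, \<lambda>_. 1}" for w
      using small[OF that ij(1,3) less ij(2,4)] f01[OF that assms(6,5)] by simp
    from this[of "tilt \<epsilon> s"] this[of "\<lambda>_. 1"] show ?thesis
      using f_swap[OF _ assms(5,6)] by auto
  next
    case equal
    have "f w x y = 1 / 2" if "w \<in> {tilt \<epsilon> s, \<lambda>_. 1}" for w
    proof -
      have "block_density K R w x = block_density K R w y"
        using ij equal by (simp add: block_density_eq)
      then show ?thesis using pos[OF that assms(5)] by (simp add: f_def)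
    qed
    from this[of "tilt \<epsilon> s"] this[of "\<lambda>_. 1"] have "f (tilt \<epsilon> s) x y = f (\<lambda>_. 1) x y"
      by simp
    then show ?thesis using \<epsilon> by simp
  next
    case greater
    have "f w x y \<in> {0..?\<delta>}" if "w \<in> {tilt \<epsilon> s, \<lambda>_. 1}" for w
      using small[OF that ij(3,1) greater ij(4,2)] f01[OF that assms(5,6)] by simp
    from this[of "tilt \<epsilon> s"] this[of "\<lambda>_. 1"] show ?thesis by auto
  qed
  then show ?thesis
    using KR \<epsilon> by (simp add: D_def P_def pmf_D_star pmf_D_tilted f_def)
qed

section \<open>Correlations of the tilted distributions\<close>

lemma sum_blocks:
  fixes g :: "nat \<Rightarrow> real"
  shows "(\<Sum>x\<in>{1..\<Sum>j=1..m. K ^ j}. g x) = (\<Sum>j=1..m. \<Sum>x\<in>block K j. g x)"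
  unfolding Union_blocks[symmetric]
proof (rule sum.UNION_disjoint)
  show "\<forall>i\<in>{1..m}. \<forall>j\<in>{1..m}. i \<noteq> j \<longrightarrow> block K i \<inter> block K j = {}"
    using block_disjoint by (metis Int_commute linorder_neqE_nat)
qed auto

text \<open>On block \<open>j\<close> the summand is constant, and the number \<open>K ^ j\<close>
  of points cancels its denominator.\<close>

lemma sum_block_density_product:
  assumes KR: "K \<ge> 1" "R \<ge> 1"
  shows "(\<Sum>x\<in>{1..\<Sum>j=1..2*R. K ^ j}.
      block_density K R v x * block_density K R w x / block_density K R (\<lambda>_. 1) x)
    = (\<Sum>j=1..2*R. v j * w j) / (2 * real R)"
proof -
  have "(\<Sum>x\<in>block K j. block_density K R v x * block_density K R w x / block_density K R (\<lambda>_. 1) x)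
      = v j * w j / (2 * real R)" if j: "j \<in> {1..2*R}" for j
  proof -
    have "(\<Sum>x\<in>block K j. block_density K R v x * block_density K R w x / block_density K R (\<lambda>_. 1) x)
        = (\<Sum>x\<in>block K j. v j * w j / (2 * real R * real K ^ j))"
      using KR by (intro sum.cong refl) (simp add: block_density_eq[OF j])
    then show ?thesis
      using KR j by (simp add: card_block)
  qed
  then show ?thesis
    unfolding sum_blocks by (simp add: sum_divide_distrib)
qed

text \<open>A pair of blocks contributes
  \<open>(1 + \<epsilon>)\<^sup>2 + (1 - \<epsilon>)\<^sup>2\<close> if the bits agree and
  \<open>2 * (1 + \<epsilon>) * (1 - \<epsilon>)\<close> otherwise.\<close>

lemma sum_tilt_product:
  "(\<Sum>j=1..2*R. tilt \<epsilon> s j * tilt \<epsilon> t j) =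
    2 * real R + 2 * \<epsilon>\<^sup>2 * (\<Sum>r=1..R. if s r = t r then 1 else - 1)"
proof (induction R)
  case (Suc R)
  have "(\<Sum>j=1..2*Suc R. tilt \<epsilon> s j * tilt \<epsilon> t j) =
      (\<Sum>j=1..2*R. tilt \<epsilon> s j * tilt \<epsilon> t j) + tilt \<epsilon> s (2*R+1) * tilt \<epsilon> t (2*R+1)
        + tilt \<epsilon> s (2*R+2) * tilt \<epsilon> t (2*R+2)"
    by simp
  moreover have "tilt \<epsilon> s (2*R+1) * tilt \<epsilon> t (2*R+1) + tilt \<epsilon> s (2*R+2) * tilt \<epsilon> t (2*R+2) =
      2 + 2 * \<epsilon>\<^sup>2 * (if s (Suc R) = t (Suc R) then 1 else - 1)"
    by (auto simp: tilt_def Let_def algebra_simps power2_eq_square)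
  ultimately show ?case using Suc.IH by (simp add: algebra_simps)
qed auto

lemma cosh_le_exp_square:
  fixes a :: real
  assumes "0 \<le> a"
  shows "cosh a \<le> exp (a\<^sup>2 / 2)"
proof -
  \<comment> \<open>The analytic core of Hoeffding's lemma for a fair coin with values 0 and 2a;
    factoring out \<open>exp a\<close> centers it.\<close>
  have "- (2 * a) * (1 / 2) + ln (1 + 1 / 2 * (exp (2 * a) - 1)) \<le> (2 * a)\<^sup>2 / 8"
    using assms by (intro Hoeffdings_lemma_aux) auto
  then have "ln (1 + 1 / 2 * (exp (2 * a) - 1)) \<le> a + a\<^sup>2 / 2"
    by (simp add: power2_eq_square)
  moreover have "1 + 1 / 2 * (exp (2 * a) - 1) = exp a * cosh a"
    by (simp add: cosh_def exp_double exp_minus divide_simps) (simp add: power2_eq_square algebra_simps flip: exp_add)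
  ultimately have "ln (exp a * cosh a) \<le> a + a\<^sup>2 / 2"
    by simp
  then have "exp (ln (exp a * cosh a)) \<le> exp (a + a\<^sup>2 / 2)"
    unfolding exp_le_cancel_iff .
  then have "exp a * cosh a \<le> exp a * exp (a\<^sup>2 / 2)"
    by (simp add: exp_add)
  then show ?thesis by simp
qed

text \<open>For fixed \<open>s\<close> the exponential factors over the bits of \<open>t\<close>,
  each giving \<open>exp a + exp (- a)\<close>, whatever \<open>s\<close> is.\<close>

lemma sum_exp_agreement:
  fixes a :: real and R :: nat
  defines "S \<equiv> {1..R} \<rightarrow>\<^sub>E (UNIV :: bool set)"
  shows "(\<Sum>s\<in>S. \<Sum>t\<in>S. exp (a * (\<Sum>r=1..R. if s r = t r then 1 else - 1))) = (4 * cosh a) ^ R"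
proof -
  have "(\<Sum>t\<in>S. exp (a * (\<Sum>r=1..R. if s r = t r then 1 else - 1))) = (2 * cosh a) ^ R"
    for s :: "nat \<Rightarrow> bool"
  proof -
    have "(\<Sum>t\<in>S. exp (a * (\<Sum>r=1..R. if s r = t r then 1 else - 1)))
        = (\<Sum>t\<in>S. \<Prod>r\<in>{1..R}. exp (a * (if s r = t r then 1 else - 1)))"
      by (simp add: exp_sum sum_distrib_left)
    also have "\<dots> = (\<Prod>r\<in>{1..R}. \<Sum>b\<in>UNIV. exp (a * (if s r = b then 1 else - 1)))"
      unfolding S_def by (subst prod_sum_PiE) auto
    also have "\<dots> = (\<Prod>r\<in>{1..R}. 2 * cosh a)"
      by (intro prod.cong) (auto simp: UNIV_bool cosh_def)
    finally show ?thesis by simp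
  qed
  moreover have "card S = 2 ^ R"
    unfolding S_def by (simp add: card_PiE)
  moreover have "2 ^ R * (2 * cosh a) ^ R = (4 * cosh a) ^ R"
    unfolding power_mult_distrib[symmetric] by simp
  ultimately show ?thesis
    by simp
qed

lemma correlation_nonneg: "0 \<le> correlation P D D'"
  unfolding correlation_def by (intro sum_nonneg) auto

text \<open>The likelihood ratio of \<open>P\<close> to itself is 1, and that of \<open>D\<close>
  has mean 1.\<close>

lemma correlation_base:
  assumes "finite (set_pmf P)" "set_pmf D \<subseteq> set_pmf P"
  shows "correlation P D P = 1" "correlation P P D = 1"
proof -
  have "pmf D x * pmf P x / pmf P x = pmf D x" if "x \<in> set_pmf P" for x
    using that by (simp add: set_pmf_iff)
  then show "correlation P D P = 1" "correlation P P D = 1"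
    using assms unfolding correlation_def by (simp_all add: sum_pmf_eq_1 mult.commute)
qed

lemma correlation_D_tilted:
  assumes "K \<ge> 1" "R \<ge> 1" "0 \<le> \<epsilon>" "\<epsilon> \<le> 1"
  shows "correlation (D_star K R) (D_tilted K R \<epsilon> s) (D_tilted K R \<epsilon> t) =
    1 + \<epsilon>\<^sup>2 / real R * (\<Sum>r=1..R. if s r = t r then 1 else - 1)"
  unfolding correlation_def set_pmf_D_star[OF assms(1,2)] pmf_D_star[OF assms(1,2)]
    pmf_D_tilted[OF assms] sum_block_density_product[OF assms(1,2)] sum_tilt_product
  using assms(2) by (simp add: add_divide_distrib)

lemma accept_prob_random_D:
  fixes R :: nat
  defines "S \<equiv> {1..R} \<rightarrow>\<^sub>E (UNIV :: bool set)"
  shows "accept_prob_random (random_D K R \<epsilon>) A =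
    (\<Sum>s\<in>S. accept_prob (D_tilted K R \<epsilon> s) A) / 2 ^ R"
proof -
  have "card S = 2 ^ R" "finite S" "S \<noteq> {}"
    unfolding S_def by (auto simp: card_PiE finite_PiE PiE_eq_empty_iff)
  then show ?thesis
    unfolding accept_prob_random_def random_D_def bind_map_pmf S_def[symmetric]
    by (simp add: pmf_bind_pmf_of_set accept_prob_def)
qed

section \<open>The distinguishing gap for fixed parameters\<close>

lemma square_gap_without_pcond:
  assumes KR: "K \<ge> 1" "R \<ge> 1" and \<epsilon>: "0 \<le> \<epsilon>" "\<epsilon> \<le> 1"
    and A: "samp_then_pcond (\<Sum>j=1..2*R. K ^ j) q 0 A"
  shows "(accept_prob_random (random_D K R \<epsilon>) A - accept_prob (D_star K R) A)\<^sup>2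
    \<le> exp ((real q * \<epsilon>\<^sup>2)\<^sup>2 / (2 * real R)) - 1"
proof -
  define S where "S = {1..R} \<rightarrow>\<^sub>E (UNIV :: bool set)"
  define P where "P = D_star K R"
  \<comment> \<open>\<open>None\<close> stands for \<open>D_star\<close> with coefficient -1, and
    \<open>Some s\<close> for the component \<open>s\<close> of the uniform mixture.\<close>
  define D where "D = (\<lambda>i. case i of None \<Rightarrow> P | Some s \<Rightarrow> D_tilted K R \<epsilon> s)"
  define c :: "(nat \<Rightarrow> bool) option \<Rightarrow> real"
    where "c = (\<lambda>i. case i of None \<Rightarrow> - 1 | Some s \<Rightarrow> 1 / 2 ^ R)"
  define I where "I = insert None (Some ` S)"
  define a where "a = real q * \<epsilon>\<^sup>2 / real R"
  have S: "finite S" "real (card S) = 2 ^ R"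
    unfolding S_def by (auto simp: card_PiE intro: finite_PiE)
  have sum_I: "(\<Sum>i\<in>I. f i) = f None + (\<Sum>s\<in>S. f (Some s))" for f :: "_ \<Rightarrow> real"
    unfolding I_def using S by (simp add: sum.reindex)
  have P: "set_pmf P = {1..\<Sum>j=1..2*R. K ^ j}"
    unfolding P_def by (rule set_pmf_D_star[OF KR])
  have supp: "set_pmf (D i) \<subseteq> {1..\<Sum>j=1..2*R. K ^ j}" for i
    using set_pmf_D_tilted[OF KR \<epsilon>] P by (auto simp: D_def split: option.split)
  have base: "correlation P (D i) P = 1" "correlation P P (D i) = 1" for i
    using correlation_base[of P "D i"] supp P by auto

  have "(\<Sum>s\<in>S. \<Sum>t\<in>S. correlation P (D (Some s)) (D (Some t)) ^ q)
      \<le> (\<Sum>s\<in>S. \<Sum>t\<in>S. exp (a * (\<Sum>r=1..R. if s r = t r then 1 else - 1)))"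
  proof (intro sum_mono)
    fix s t :: "nat \<Rightarrow> bool"
    let ?T = "\<Sum>r=1..R. if s r = t r then 1 else - 1 :: real"
    have "correlation P (D (Some s)) (D (Some t)) = 1 + \<epsilon>\<^sup>2 / real R * ?T"
      using correlation_D_tilted[OF KR \<epsilon>] by (simp add: P_def D_def)
    also have "\<dots> \<le> exp (\<epsilon>\<^sup>2 / real R * ?T)"
      by (rule exp_ge_add_one_self)
    \<comment> \<open>Raising to the power \<open>q\<close> needs the left side to be nonnegative,
      which holds for every correlation.\<close>
    finally have "correlation P (D (Some s)) (D (Some t)) ^ q \<le> exp (\<epsilon>\<^sup>2 / real R * ?T) ^ q"
      by (intro power_mono correlation_nonneg)
    also have "\<dots> = exp (a * ?T)"
      unfolding exp_of_nat_mult[symmetric] a_def by (simp add: mult.assoc)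
    finally show "correlation P (D (Some s)) (D (Some t)) ^ q \<le> exp (a * ?T)" .
  qed
  also have "\<dots> = (4 * cosh a) ^ R"
    unfolding S_def by (rule sum_exp_agreement)
  also have "\<dots> \<le> (4 * exp (a\<^sup>2 / 2)) ^ R"
    by (intro power_mono mult_left_mono cosh_le_exp_square) (auto simp: a_def)
  also have "\<dots> = 4 ^ R * exp (real R * (a\<^sup>2 / 2))"
    unfolding power_mult_distrib exp_of_nat_mult ..
  also have "real R * (a\<^sup>2 / 2) = (real q * \<epsilon>\<^sup>2)\<^sup>2 / (2 * real R)"
    using KR by (simp add: a_def power_divide power2_eq_square)
  finally have "(\<Sum>s\<in>S. \<Sum>t\<in>S. correlation P (D (Some s)) (D (Some t)) ^ q) / 4 ^ R
      \<le> exp ((real q * \<epsilon>\<^sup>2)\<^sup>2 / (2 * real R))"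
    by (simp add: divide_le_eq mult.commute)
  \<comment> \<open>The pair (\<open>None\<close>, \<open>None\<close>) contributes 1 and the two
    families of cross terms contribute -1 each, leaving -1.\<close>
  moreover have "correlation_form P D I q c =
      (\<Sum>s\<in>S. \<Sum>t\<in>S. correlation P (D (Some s)) (D (Some t)) ^ q) / 4 ^ R - 1"
  proof -
    have D_None: "D None = P" by (simp add: D_def)
    have pow4: "(4 :: real) ^ R = 2 ^ R * 2 ^ R"
      unfolding power_mult_distrib[symmetric] by simp
    show ?thesis
      unfolding correlation_form_def sum_I D_None base
      by (simp add: c_def base S sum.distrib sum_subtractf sum_negf sum_divide_distrib pow4 D_None)
  qed
  moreover have "(\<Sum>i\<in>I. c i * accept_prob (D i) A) =
      accept_prob_random (random_D K R \<epsilon>) A - accept_prob P A"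
    unfolding sum_I accept_prob_random_D
    by (simp add: c_def D_def sum_divide_distrib S_def)
  moreover have "(\<Sum>i\<in>I. c i * accept_prob (D i) A)\<^sup>2 \<le> correlation_form P D I q c"
    using A P supp by (intro square_accept_prob_le_correlation_form) auto
  ultimately show ?thesis
    unfolding P_def by simp
qed

text \<open>The first term pays for simulating \<open>Pcond\<close> under the tilted distributions,
  the second for the samples; under \<open>D_star\<close> the simulation is exact.\<close>

lemma gap_le:
  assumes KR: "K \<ge> 1" "R \<ge> 1" and \<epsilon>: "0 \<le> \<epsilon>" "\<epsilon> < 1"
    and A: "samp_then_pcond (\<Sum>j=1..2*R. K ^ j) q n A"
  shows "\<bar>accept_prob_random (random_D K R \<epsilon>) A - accept_prob (D_star K R) A\<bar>
    \<le> real n * (2 / ((1 - \<epsilon>) * real K)) + sqrt (exp ((real q * \<epsilon>\<^sup>2)\<^sup>2 / (2 * real R)) - 1)"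
proof -
  define S where "S = {1..R} \<rightarrow>\<^sub>E (UNIV :: bool set)"
  let ?P = "D_star K R" and ?\<D> = "random_D K R \<epsilon>" and ?\<delta> = "2 / ((1 - \<epsilon>) * real K)"
  let ?A = "simulate_pcond ?P A"
  have S: "real (card S) = 2 ^ R"
    unfolding S_def by (simp add: card_PiE)
  have "\<bar>accept_prob_random ?\<D> A - accept_prob_random ?\<D> ?A\<bar> =
      \<bar>\<Sum>s\<in>S. accept_prob (D_tilted K R \<epsilon> s) A - accept_prob (D_tilted K R \<epsilon> s) ?A\<bar> / 2 ^ R"
    unfolding accept_prob_random_D S_def
    by (simp add: sum_subtractf abs_divide flip: diff_divide_distrib)
  also have "\<dots> \<le> (\<Sum>s\<in>S. real n * ?\<delta>) / 2 ^ R"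
  proof (intro divide_right_mono order_trans[OF sum_abs] sum_mono)
    fix s
    show "\<bar>accept_prob (D_tilted K R \<epsilon> s) A - accept_prob (D_tilted K R \<epsilon> s) ?A\<bar> \<le> real n * ?\<delta>"
    proof (rule accept_prob_simulate_pcond_diff[OF A])
      show "set_pmf (D_tilted K R \<epsilon> s) \<subseteq> {1..\<Sum>j=1..2*R. K ^ j}"
        using KR \<epsilon> by (intro set_pmf_D_tilted) auto
    qed (use \<epsilon> in \<open>auto intro!: pcond_prob_D_tilted_diff[OF KR \<epsilon>] simp del: sum.cl_ivl_Suc\<close>)
  qed auto
  also have "\<dots> = real n * ?\<delta>"
    by (simp add: S)
  finally have "\<bar>accept_prob_random ?\<D> A - accept_prob_random ?\<D> ?A\<bar> \<le> real n * ?\<delta>" .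
  moreover have "\<bar>accept_prob_random ?\<D> ?A - accept_prob ?P ?A\<bar>
      \<le> sqrt (exp ((real q * \<epsilon>\<^sup>2)\<^sup>2 / (2 * real R)) - 1)"
    using square_gap_without_pcond[OF KR \<epsilon>(1) _ samp_then_pcond_simulate_pcond[OF A]] \<epsilon>
    by (intro real_le_rsqrt) simp
  moreover have "accept_prob ?P ?A = accept_prob ?P A"
    by (rule accept_prob_simulate_pcond_same)
  ultimately show ?thesis by linarith
qed

section \<open>Asymptotics\<close>

lemma sqrt_exp_le:
  fixes t :: real
  assumes "0 \<le> t" "t \<le> 1"
  shows "sqrt (exp (t\<^sup>2 / 2) - 1) \<le> t"
proof -
  have "t\<^sup>2 \<le> 1"
    using assms by (simp add: power_le_one)
  then have "exp (t\<^sup>2 / 2) \<le> 1 + t\<^sup>2 / 2 + (t\<^sup>2 / 2)\<^sup>2"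
    by (intro exp_bound) auto
  also have "(t\<^sup>2 / 2)\<^sup>2 \<le> t\<^sup>2 / 2 * 1"
    unfolding power2_eq_square[of "t\<^sup>2 / 2"] using \<open>t\<^sup>2 \<le> 1\<close> by (intro mult_left_mono) auto
  finally show ?thesis
    using assms(1) by (intro real_le_lsqrt) auto
qed

text \<open>The last block alone has at least \<open>4 ^ R\<close> points. This compares the query
  bound, of order \<open>sqrt R / \<epsilon>\<^sup>2\<close>, with \<open>K\<close>, of order
  \<open>ln N / \<epsilon>\<^sup>2\<close>.\<close>

lemma sqrt_le_ln_domain:
  assumes "K \<ge> 2" "R \<ge> 1"
  shows "sqrt (real R) \<le> ln (real (\<Sum>j=1..2*R. K ^ j))"
proof -
  have "2 ^ (2 * R) \<le> K ^ (2 * R)"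
    using assms by (intro power_mono) auto
  also have "\<dots> \<le> (\<Sum>j=1..2*R. K ^ j)"
    using assms by (intro member_le_sum) auto
  finally have "real (2 ^ (2 * R)) \<le> real (\<Sum>j=1..2*R. K ^ j)"
    unfolding of_nat_le_iff .
  then have *: "ln (4 ^ R) \<le> ln (real (\<Sum>j=1..2*R. K ^ j))"
    by (intro ln_mono) (auto simp: power_mult)
  have "1 \<le> ln (4 :: real)"
    using exp_le by (subst ln_ge_iff) auto
  then have "real R * 1 \<le> real R * ln 4"
    by (intro mult_left_mono) auto
  also have "\<dots> = ln (4 ^ R)"
    by (simp add: ln_realpow)
  finally have "real R \<le> ln (real (\<Sum>j=1..2*R. K ^ j))"
    using * by simp
  moreover have "sqrt (real R) \<le> real R"
    using assms by (intro real_le_lsqrt) (auto simp: power2_eq_square)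
  ultimately show ?thesis by linarith
qed

theorem theoremA2:
  fixes \<epsilon> :: "nat \<Rightarrow> real" and \<epsilon>0 :: real and N K R q :: "nat \<Rightarrow> nat"
  assumes "\<epsilon>0 < 1" and "\<And>n. 0 < \<epsilon> n" and "\<And>n. \<epsilon> n \<le> \<epsilon>0"
    and "filterlim N at_top sequentially"
    and "\<And>n. N n = (\<Sum>i=1..2 * R n. K n ^ i)"
    and "(\<lambda>n. real (K n)) \<in> \<Theta>(\<lambda>n. ln (real (N n)) / (\<epsilon> n)\<^sup>2)"
    and "(\<lambda>n. real (R n)) \<in> \<Theta>(\<lambda>n. ln (real (N n)) / ln (ln (real (N n)) / \<epsilon> n))"
    and "(\<lambda>n. real (q n)) \<in> o(\<lambda>n. sqrt (real (R n)) / (\<epsilon> n)\<^sup>2)"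
  shows "\<forall>\<^sub>F n in sequentially. \<forall>A. samp_then_pcond (N n) (q n) (q n) A \<longrightarrow>
           \<bar>accept_prob_random (random_D (K n) (R n) (\<epsilon> n)) A
             - accept_prob (D_star (K n) (R n)) A\<bar> < 1 / 3"
proof -
  obtain C where C: "C > 0"
    and K_lower: "\<forall>\<^sub>F n in sequentially. C * norm (ln (real (N n)) / (\<epsilon> n)\<^sup>2) \<le> norm (real (K n))"
    using landau_omega.bigE[OF bigthetaD2[OF assms(6)]] by blast
  \<comment> \<open>\<open>t\<close> will bound the ratio of \<open>q\<close> to its scale. The
    \<open>Pcond\<close> error is then at most \<open>t * B\<close> and the sampling error at most
    \<open>t\<close>; the choice of \<open>t\<close> makes their sum 1/4.\<close>
  define B where "B = 2 / ((1 - \<epsilon>0) * C)"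
  define t where "t = 1 / (4 * (1 + B))"
  have B: "0 < B" using C assms(1) by (simp add: B_def)
  have t: "0 < t" "t \<le> 1" "t * (B + 1) < 1 / 3"
    using B by (auto simp: t_def field_simps)
  have q_upper: "\<forall>\<^sub>F n in sequentially.
      norm (real (q n)) \<le> t * norm (sqrt (real (R n)) / (\<epsilon> n)\<^sup>2)"
    using landau_o.smallD[OF assms(8) t(1)] .
  have "filterlim (\<lambda>n. ln (real (N n))) at_top sequentially"
    by (intro filterlim_compose[OF ln_at_top] filterlim_compose[OF filterlim_real_sequentially] assms(4))
  \<comment> \<open>The threshold \<open>2 / C\<close> forces \<open>K n\<close> to be at least 2,
    since \<epsilon> is below 1.\<close>
  then have "\<forall>\<^sub>F n in sequentially. 2 / C \<le> ln (real (N n))"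
    by (simp add: filterlim_at_top)
  then show ?thesis
    using K_lower q_upper
  proof eventually_elim
    case (elim n)
    let ?L = "ln (real (N n))" and ?\<epsilon> = "\<epsilon> n"
    have \<epsilon>: "0 < ?\<epsilon>" "?\<epsilon> < 1" "0 < ?\<epsilon>\<^sup>2" "?\<epsilon>\<^sup>2 \<le> 1"
      using assms(1) assms(2,3)[of n] by (auto simp: power_le_one)
    have L: "2 \<le> C * ?L" "0 < ?L"
      using elim(1) C by (auto simp: field_simps intro: less_le_trans[of 0 "2 / C"])
    have K: "C * ?L / ?\<epsilon>\<^sup>2 \<le> real (K n)"
      using elim(2) L \<epsilon> by simp
    have "2 / 1 \<le> C * ?L / ?\<epsilon>\<^sup>2"
      using L \<epsilon> by (intro frac_le) auto
    with K have "K n \<ge> 2" by linarith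
    \<comment> \<open>For \<open>R n = 0\<close> the domain is empty, and \<open>ln 0 = 0\<close>
      contradicts the positivity of the logarithm.\<close>
    have "R n \<ge> 1"
      using L assms(5)[of n] by (cases "R n") auto
    have q: "real (q n) \<le> t * (sqrt (real (R n)) / ?\<epsilon>\<^sup>2)"
      using elim(3) by simp
    have sqrt_R: "sqrt (real (R n)) \<le> ?L"
      unfolding assms(5) by (rule sqrt_le_ln_domain) fact+

    \<comment> \<open>Both \<open>q\<close> and \<open>K\<close> are compared with
      \<open>ln N / \<epsilon>\<^sup>2\<close>, which then cancels.\<close>
    have "real (q n) * (2 / ((1 - ?\<epsilon>) * real (K n)))
        \<le> t * (?L / ?\<epsilon>\<^sup>2) * (2 / ((1 - \<epsilon>0) * (C * ?L / ?\<epsilon>\<^sup>2)))"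
    proof (intro mult_mono)
      show "real (q n) \<le> t * (?L / ?\<epsilon>\<^sup>2)"
        using sqrt_R t \<epsilon> by (intro order_trans[OF q] mult_left_mono divide_right_mono) auto
      show "2 / ((1 - ?\<epsilon>) * real (K n)) \<le> 2 / ((1 - \<epsilon>0) * (C * ?L / ?\<epsilon>\<^sup>2))"
        using K assms(1,3) L C \<epsilon> by (intro frac_le mult_mono mult_pos_pos divide_pos_pos) auto
    qed (use t L \<epsilon> in auto)
    also have "\<dots> = t * B"
    proof -
      have "t * X * (2 / ((1 - \<epsilon>0) * (C * X))) = t * B" if "X \<noteq> 0" for X
        using that by (simp add: B_def)
      from this[of "?L / ?\<epsilon>\<^sup>2"] show ?thesis using L \<epsilon> by simp
    qed
    finally have pcond_part: "real (q n) * (2 / ((1 - ?\<epsilon>) * real (K n))) \<le> t * B" .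

    have "real (q n) * ?\<epsilon>\<^sup>2 \<le> t * sqrt (real (R n))"
      using q \<epsilon> by (simp add: field_simps)
    then have "(real (q n) * ?\<epsilon>\<^sup>2)\<^sup>2 \<le> (t * sqrt (real (R n)))\<^sup>2"
      by (intro power_mono) auto
    then have "(real (q n) * ?\<epsilon>\<^sup>2)\<^sup>2 / (2 * real (R n)) \<le> t\<^sup>2 / 2"
      using \<open>R n \<ge> 1\<close> by (simp add: power_mult_distrib field_simps)
    then have "sqrt (exp ((real (q n) * ?\<epsilon>\<^sup>2)\<^sup>2 / (2 * real (R n))) - 1) \<le> sqrt (exp (t\<^sup>2 / 2) - 1)"
      by simp
    also have "\<dots> \<le> t"
      using t by (intro sqrt_exp_le) auto
    finally have samp_part: "sqrt (exp ((real (q n) * ?\<epsilon>\<^sup>2)\<^sup>2 / (2 * real (R n))) - 1) \<le> t" .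

    show ?case
    proof (intro allI impI)
      fix A
      assume "samp_then_pcond (N n) (q n) (q n) A"
      then have "\<bar>accept_prob_random (random_D (K n) (R n) ?\<epsilon>) A - accept_prob (D_star (K n) (R n)) A\<bar>
          \<le> t * B + t"
        using gap_le[of "K n" "R n" ?\<epsilon> "q n" "q n" A] pcond_part samp_part
          \<open>K n \<ge> 2\<close> \<open>R n \<ge> 1\<close> \<epsilon> assms(5)[of n] by simp
      also have "\<dots> < 1 / 3"
        using t(3) by (simp add: algebra_simps)
      finally show "\<bar>accept_prob_random (random_D (K n) (R n) ?\<epsilon>) A
          - accept_prob (D_star (K n) (R n)) A\<bar> < 1 / 3" .
    qed
  qed
qed

end
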